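(* Let $G$ be an infinite abelian group, and let $C$ be a finite non-empty subset of $G$. Then $C$ is a minimal complement in $G$, i.e., there exists $W \subseteq G$ such that $W + C = G$ and $W + C' \neq G$ for every proper subset $C' \subsetneq C$.
   Context: For subsets $A,B$ of an abelian group, $A+B=\{a+b : a\in A, b\in B\}$. *)

theory Defs
  imports Main "HOL-Library.Set_Algebras"
begin

text \<open>
  The ambient abelian group is the whole type \<open>'a\<close>, so \<open>G\<close> is \<open>UNIV\<close>, and \<open>W + C\<close> is the
  sumset of \<^theory>\<open>HOL-Library.Set_Algebras\<close>.
\<close>

definition minimal_complement_to :: "'a::ab_group_add set \<Rightarrow> 'a set \<Rightarrow> bool" where
  "minimal_complement_to C W \<longleftrightarrow>
     W + C = UNIV \<and> (\<forall>C'. C' \<subset> C \<longrightarrow> W + C' \<noteq> UNIV)"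

definition is_minimal_complement :: "'a::ab_group_add set \<Rightarrow> bool" where
  "is_minimal_complement C \<longleftrightarrow> (\<exists>W. minimal_complement_to C W)"

end

(* Pick points g c (c in C) so far apart that the finite sets g c - C do not interact, and let W be
   the complement of the union of the sets g c - (C - {c}). Then g c is not in W + C' when C' omits
   c. If some x were outside W + C, then x - C would lie in that union, by the separation inside a
   single g c - (C - {c}), which has one element too few. *)
theory Submission
  imports Defs
begin

text \<open>Greedy choice: the values chosen so far forbid only finitely many positions for the next
  one, and the group is infinite.\<close>

lemma separated_family_exists:
  fixes F :: "'a::ab_group_add set"
  assumes "infinite (UNIV :: 'a set)" and "finite F" and "finite A"
  shows "\<exists>g :: 'b \<Rightarrow> 'a. \<forall>c\<in>A. \<forall>d\<in>A. c \<noteq> d \<longrightarrow> g c - g d \<notin> F"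
  using \<open>finite A\<close>
proof (induction A rule: finite_induct)
  case empty
  show ?case by simp
next
  case (insert x A)
  then obtain g :: "'b \<Rightarrow> 'a" where g: "\<forall>c\<in>A. \<forall>d\<in>A. c \<noteq> d \<longrightarrow> g c - g d \<notin> F"
    by blast
  \<comment> \<open>\<open>F\<close> need not be symmetric, so the new value \<open>y\<close> has to
    avoid it in both orders: \<open>y - g d\<close> and \<open>g d - y\<close>.\<close>
  let ?B = "\<Union>d\<in>A. (\<lambda>f. g d + f) ` F \<union> (\<lambda>f. g d - f) ` F"
  have "finite ?B"
    using insert.hyps(1) \<open>finite F\<close> by simp
  then obtain y where y: "y \<notin> ?B"
    using assms(1) ex_new_if_finite by blast
  have "y - g d \<notin> F" if "d \<in> A" for d
  proof
    assume "y - g d \<in> F"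
    with that have "g d + (y - g d) \<in> ?B" by blast
    with y show False by simp
  qed
  moreover have "g d - y \<notin> F" if "d \<in> A" for d
  proof
    assume "g d - y \<in> F"
    with that have "g d - (g d - y) \<in> ?B" by blast
    with y show False by simp
  qed
  ultimately have "\<forall>c\<in>insert x A. \<forall>d\<in>insert x A. c \<noteq> d \<longrightarrow> (g(x := y)) c - (g(x := y)) d \<notin> F"
    using g insert.hyps(2) by auto
  then show ?case by blast
qed

theorem theorem1p2:
  fixes C :: "'a::ab_group_add set"
  assumes "infinite (UNIV :: 'a set)"
    and "finite C"
    and "C \<noteq> {}"
  shows "is_minimal_complement C"
proof -
  \<comment> \<open>If \<open>x - b = g c - p\<close> and \<open>x - e = g d - q\<close>, then
    \<open>g c - g d = p - b + e - q\<close>. Excluding all such differences keeps a translate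
    \<open>x - C\<close> from meeting two of the sets \<open>g c - C\<close>.\<close>
  let ?F = "(\<lambda>(p, q, r, s). p - q + r - s) ` (C \<times> C \<times> C \<times> C)"
  have "finite ?F"
    using \<open>finite C\<close> by simp
  then obtain g :: "'a \<Rightarrow> 'a" where g: "\<forall>c\<in>C. \<forall>d\<in>C. c \<noteq> d \<longrightarrow> g c - g d \<notin> ?F"
    using separated_family_exists[OF assms(1) _ \<open>finite C\<close>] by blast
  define R where "R = (\<Union>c\<in>C. (\<lambda>y. g c - y) ` (C - {c}))"
  have "x \<in> - R + C" for x
  proof (rule ccontr)
    assume x: "x \<notin> - R + C"
    have mem: "x - b \<in> R" if "b \<in> C" for b
    proof (rule ccontr)
      assume "x - b \<notin> R"
      then have "(x - b) + b \<in> - R + C"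
        using that by (intro set_plus_intro) auto
      with x show False by simp
    qed
    \<comment> \<open>One reference element \<open>b\<close> fixes the index \<open>c\<close>;
      separation then forces \<open>x - e\<close> into the block of the same \<open>c\<close> for
      every \<open>e\<close> in \<open>C\<close>.\<close>
    obtain b where "b \<in> C" using \<open>C \<noteq> {}\<close> by blast
    with mem obtain c p where cp: "c \<in> C" "p \<in> C" "x - b = g c - p"
      unfolding R_def by blast
    have "x - e \<in> (\<lambda>y. g c - y) ` (C - {c})" if "e \<in> C" for e
    proof -
      from mem[OF that] obtain d q where dq: "d \<in> C" "q \<in> C - {d}" "x - e = g d - q"
        unfolding R_def by blast
      have "g c - g d = p - b + e - q"
      proof -
        have "g c = x - b + p" "g d = x - e + q"
          using cp(3) dq(3) by simp_all
        then show ?thesis by (simp only:) (simp add: algebra_simps)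
      qed
      moreover have "p - b + e - q \<in> ?F"
        using cp(2) \<open>b \<in> C\<close> that dq(2) by (intro image_eqI[where x = "(p, b, e, q)"]) auto
      ultimately have "c = d"
        using g cp(1) dq(1) by metis
      with dq show ?thesis by blast
    qed
    \<comment> \<open>Subtraction from \<open>x\<close> is injective, so \<open>card C\<close>
      elements would have to fit into a block with fewer elements.\<close>
    then have "(\<lambda>y. x - y) ` C \<subseteq> (\<lambda>y. g c - y) ` (C - {c})"
      by blast
    then have "card ((\<lambda>y. x - y) ` C) \<le> card ((\<lambda>y. g c - y) ` (C - {c}))"
      using \<open>finite C\<close> by (intro card_mono) auto
    also have "\<dots> \<le> card (C - {c})"
      using \<open>finite C\<close> by (intro card_image_le) auto
    also have "\<dots> < card C"
      using \<open>finite C\<close> cp(1) by (rule card_Diff1_less)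
    also have "card C = card ((\<lambda>y. x - y) ` C)"
      by (simp add: card_image inj_on_def)
    finally show False by simp
  qed
  then have "- R + C = UNIV" by blast
  moreover have "- R + C' \<noteq> UNIV" if sub: "C' \<subset> C" for C'
  proof -
    obtain c where c: "c \<in> C" "c \<notin> C'" using sub by blast
    \<comment> \<open>Every \<open>b\<close> in \<open>C'\<close> lies in \<open>C - {c}\<close>, so
      the only possible partner \<open>g c - b\<close> was put into \<open>R\<close>.\<close>
    have "g c \<notin> - R + C'"
    proof
      assume "g c \<in> - R + C'"
      then obtain w b where "w \<notin> R" "b \<in> C'" "g c = w + b"
        by (auto elim!: set_plus_elim)
      moreover from this have "w = g c - b" by simp
      ultimately show False
        using c sub unfolding R_def by blast
    qed
    then show ?thesis by blast
  qed
  ultimately show ?thesis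
    unfolding is_minimal_complement_def minimal_complement_to_def by blast
qed

end
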